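(* Let $f\in C^{3}(\mathbb{R})$ be a real-valued function and suppose that $f''$ has finitely many zeros in $\mathbb{R}$. If $f''$ is not nonnegative on $\mathbb{R}$ (that is, $f''(x)<0$ for some $x\in\mathbb{R}$), then there is a point $P$ below the graph of $f$ whose illumination index is not equal to $2$.
   Context: A point $P=(s,t)$ lies below the graph of $f$ if $t<f(s)$. The tangent line to the graph of $f$ at $(c,f(c))$ is the line $y=T_c(x)$, where $T_c(x)=f(c)+f'(c)(x-c)$; it passes through $P=(s,t)$ if $T_c(s)=t$. For a point $P$ not on the graph of $f$, the illumination index of $P$ is the number of distinct tangent lines to the graph of $f$ which pass through $P$ (possibly $0$ or $\infty$). A line which is tangent to the graph at more than one point is counted only once. *)

theory Defs
  imports "HOL-Analysis.Analysis" "HOL-Library.Extended_Nat"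
begin

definition C_k_on_reals :: "nat \<Rightarrow> (real \<Rightarrow> real) \<Rightarrow> bool" where
  "C_k_on_reals k f \<longleftrightarrow>
     (\<forall>j<k. \<forall>x. (deriv ^^ j) f field_differentiable (at x)) \<and>
     continuous_on UNIV ((deriv ^^ k) f)"

definition below_graph :: "(real \<Rightarrow> real) \<Rightarrow> real \<times> real \<Rightarrow> bool" where
  "below_graph f P \<longleftrightarrow> snd P < f (fst P)"

definition tangent_fun :: "(real \<Rightarrow> real) \<Rightarrow> real \<Rightarrow> real \<Rightarrow> real" where
  "tangent_fun f c x = f c + deriv f c * (x - c)"

definition tangent_line :: "(real \<Rightarrow> real) \<Rightarrow> real \<Rightarrow> (real \<times> real) set" where
  "tangent_line f c = {(x, y). y = tangent_fun f c x}"

(* Tangent lines are collected as subsets of the plane, not as points of tangency,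
   so a line that is tangent at several points is counted once. *)
definition tangents_through :: "(real \<Rightarrow> real) \<Rightarrow> real \<times> real \<Rightarrow> (real \<times> real) set set" where
  "tangents_through f P = {L. \<exists>c. L = tangent_line f c \<and> P \<in> L}"

(* The value is \<infinity> when there are infinitely many tangent lines through P, since card
   of an infinite set is 0.  The index is meant for points P off the graph of f. *)
definition illumination_index :: "(real \<Rightarrow> real) \<Rightarrow> real \<times> real \<Rightarrow> enat" where
  "illumination_index f P =
     (if finite (tangents_through f P) then enat (card (tangents_through f P)) else \<infinity>)"

end

theory Submission
  imports Defs
begin

text \<open>
  Fix \<open>s\<close> and follow the height \<open>c \<mapsto> tangent_fun f c s\<close> at which the tangent line at \<open>c\<close>
  crosses the vertical line through \<open>s\<close>; a point \<open>(s, t)\<close> is illuminated by the tangent at \<open>c\<close>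
  when this height is \<open>t\<close>, and at \<open>c = s\<close> the height is \<open>f s\<close>.

  If \<open>f''\<close> is nowhere positive, every tangent lies above the concave function \<open>f\<close>, and a point
  below the graph has index \<open>0\<close>.

  Otherwise \<open>f''\<close> takes both signs and, its zeros being finite in number, it changes sign at some
  inflection point \<open>a\<close> (\<open>sign_change_at_zero\<close>): strictly convex between \<open>p\<close> and \<open>a\<close>, strictly
  concave between \<open>a\<close> and \<open>b\<close>. The tangent at \<open>b\<close> passes above \<open>(a, f a)\<close>, hence also above
  \<open>(s, f s)\<close> for \<open>s\<close> close to \<open>a\<close> on the convex side, while the tangents at \<open>p\<close> and at \<open>a\<close> pass
  below \<open>(s, f s)\<close>. So as \<open>c\<close> runs through \<open>p, s, a, b\<close> the height is alternately below and above
  any \<open>t\<close> slightly less than \<open>f s\<close>, and takes the value \<open>t\<close> three times. The three lines are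
  distinct (\<open>three_tangents_at_inflection\<close>), so the index is at least \<open>3\<close>.

  Which of the two sides of \<open>a\<close> is the convex one does not matter: all intervals are written as
  segments with unordered endpoints, so that both orientations are treated at once.
\<close>

section \<open>Tangents and the sign of the second derivative\<close>

lemma tangent_less_if_second_deriv_pos:
  fixes f f' f'' :: "real \<Rightarrow> real"
  assumes f: "\<And>x. (f has_real_derivative f' x) (at x)"
    and f': "\<And>x. (f' has_real_derivative f'' x) (at x)"
    and pos: "\<And>y. y \<in> open_segment c x \<Longrightarrow> f'' y > 0"
    and "c \<noteq> x"
  shows "f c + f' c * (x - c) < f x"
proof -
  have cont: "continuous_on A f'" for A
    using f' by (meson DERIV_isCont continuous_at_imp_continuous_on)
  show ?thesis
  proof (cases "c < x")
    case True
    obtain z where z: "c < z" "z < x" "f x - f c = (x - c) * f' z"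
      using MVT2[OF True, of f f'] f by auto
    have "f' c < f' z"
    proof (rule DERIV_pos_imp_increasing_open[OF z(1) _ cont])
      fix y assume "c < y" "y < z"
      then show "\<exists>l. DERIV f' y :> l \<and> 0 < l"
        using f'[of y] pos[of y] True z by (auto simp: open_segment_eq_real_ivl)
    qed
    then have "f' c * (x - c) < f' z * (x - c)"
      using True by simp
    moreover have "f x - f c = f' z * (x - c)"
      using z(3) by (simp add: mult.commute)
    ultimately show ?thesis by linarith
  next
    case False
    then have less: "x < c" using \<open>c \<noteq> x\<close> by simp
    obtain z where z: "x < z" "z < c" "f c - f x = (c - x) * f' z"
      using MVT2[OF less, of f f'] f by auto
    have "f' z < f' c"
    proof (rule DERIV_pos_imp_increasing_open[OF z(2) _ cont])
      fix y assume "z < y" "y < c"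
      then show "\<exists>l. DERIV f' y :> l \<and> 0 < l"
        using f'[of y] pos[of y] less z by (auto simp: open_segment_eq_real_ivl)
    qed
    then have "f' z * (c - x) < f' c * (c - x)"
      using less by simp
    then show ?thesis using z by (simp add: algebra_simps)
  qed
qed

lemma tangent_greater_if_second_deriv_neg:
  fixes f f' f'' :: "real \<Rightarrow> real"
  assumes f: "\<And>x. (f has_real_derivative f' x) (at x)"
    and f': "\<And>x. (f' has_real_derivative f'' x) (at x)"
    and neg: "\<And>y. y \<in> open_segment c x \<Longrightarrow> f'' y < 0"
    and "c \<noteq> x"
  shows "f x < f c + f' c * (x - c)"
  using tangent_less_if_second_deriv_pos
      [of "\<lambda>x. - f x" "\<lambda>x. - f' x" "\<lambda>x. - f'' x" c x] assms
  by (force intro: DERIV_minus)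

lemma tangent_ge_if_second_deriv_nonpos:
  fixes f f' f'' :: "real \<Rightarrow> real"
  assumes f: "\<And>x. (f has_real_derivative f' x) (at x)"
    and f': "\<And>x. (f' has_real_derivative f'' x) (at x)"
    and nonpos: "\<And>y. f'' y \<le> 0"
  shows "f x \<le> f c + f' c * (x - c)"
proof -
  have "convex_on UNIV (\<lambda>x. - f x)"
    by (rule f''_ge0_imp_convex[of UNIV _ "\<lambda>x. - f' x" "\<lambda>x. - f'' x"])
       (use assms in \<open>auto intro: DERIV_minus\<close>)
  then have "- f x - - f c \<ge> - f' c * (x - c)"
    by (rule convex_on_imp_above_tangent) (use DERIV_minus[OF f] in auto)
  then show ?thesis by simp
qed

section \<open>Sign changes of functions with finitely many zeros\<close>

lemma finite_avoid_segment:
  fixes a x :: real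
  assumes "finite Z" and "x \<noteq> a"
  obtains p where "p \<in> closed_segment x a" "p \<noteq> a" "open_segment p a \<inter> Z = {}"
proof -
  have "\<exists>p \<in> closed_segment x a. p \<noteq> a \<and> open_segment p a \<inter> Z = {}"
    using \<open>finite Z\<close>
  proof induction
    case empty
    then show ?case using \<open>x \<noteq> a\<close> by auto
  next
    case (insert z Z)
    then obtain p where p: "p \<in> closed_segment x a" "p \<noteq> a" "open_segment p a \<inter> Z = {}"
      by blast
    show ?case
    proof (cases "z \<in> open_segment p a")
      case True
      then have "z \<in> closed_segment x a" "z \<noteq> a" "open_segment z a \<inter> insert z Z = {}"
        using p by (force simp: open_segment_eq_real_ivl closed_segment_eq_real_ivl disjoint_iff
            split: if_splits)+
      then show ?thesis by blast
    next
      case False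
      then show ?thesis using p by blast
    qed
  qed
  then show ?thesis using that by blast
qed

text \<open>
  Choose points \<open>x\<close>, \<open>y\<close> with \<open>g x > 0 > g y\<close> and as few zeros of \<open>g\<close> between them as possible.
  Then \<open>g \<ge> 0\<close> between \<open>x\<close> and any zero \<open>a\<close> in between: a point there with a negative value could
  replace \<open>y\<close> and save the zero \<open>a\<close>. Likewise \<open>g \<le> 0\<close> between \<open>a\<close> and \<open>y\<close>. Zeros without a sign
  change may remain, and are avoided by moving closer to \<open>a\<close>.
\<close>

lemma sign_change_at_zero:
  fixes g :: "real \<Rightarrow> real"
  assumes cont: "continuous_on UNIV g"
    and fin: "finite {x. g x = 0}"
    and "g x\<^sub>0 > 0" "g y\<^sub>0 < 0"
  obtains p a b where "p \<noteq> a" "b \<noteq> a"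
    "\<And>u. u \<in> open_segment p a \<Longrightarrow> g u > 0" "\<And>u. u \<in> open_segment a b \<Longrightarrow> g u < 0"
proof -
  define zeros where "zeros x y = {z \<in> closed_segment x y. g z = 0}" for x y
  have fin_zeros: "finite (zeros x y)" for x y
    using fin by (rule rev_finite_subset) (auto simp: zeros_def)
  define N where "N = (\<lambda>(x, y). card (zeros x y))"
  obtain x y where xy: "g x > 0" "g y < 0"
    and minimal: "\<And>x' y'. g x' > 0 \<Longrightarrow> g y' < 0 \<Longrightarrow> card (zeros x y) \<le> card (zeros x' y')"
    using ex_has_least_nat[of "\<lambda>(x, y). g x > 0 \<and> g y < 0" "(x\<^sub>0, y\<^sub>0)" N] assms(3,4)
    by (auto simp: N_def)
  have "connected (g ` closed_segment x y)"
    using cont by (intro connected_continuous_image) (auto intro: continuous_on_subset)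
  then have "0 \<in> g ` closed_segment x y"
    using xy connectedD_interval[of "g ` closed_segment x y" "g y" "g x" 0] by auto
  then obtain a where a: "a \<in> closed_segment x y" "g a = 0" by auto
  have "x \<noteq> a" "y \<noteq> a" using a xy by auto
  have no_fewer_zeros: False
    if "closed_segment x' y' \<subseteq> closed_segment x y - {a}" "g x' > 0" "g y' < 0" for x' y'
  proof -
    have "zeros x' y' \<subset> zeros x y" using that a by (auto simp: zeros_def)
    then have "card (zeros x' y') < card (zeros x y)"
      by (intro psubset_card_mono fin_zeros)
    then show False using minimal[of x' y'] that by simp
  qed
  have left: "g u \<ge> 0" if u: "u \<in> closed_segment x a" for u
  proof (rule ccontr)
    assume neg: "\<not> g u \<ge> 0"
    then have "u \<noteq> a" using a by auto
    then have "closed_segment x u \<subseteq> closed_segment x y - {a}"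
      using u a by (auto simp: closed_segment_eq_real_ivl split: if_splits)
    then show False using no_fewer_zeros[of x u] xy neg by auto
  qed
  have right: "g u \<le> 0" if u: "u \<in> closed_segment y a" for u
  proof (rule ccontr)
    assume pos: "\<not> g u \<le> 0"
    then have "u \<noteq> a" using a by auto
    then have "closed_segment u y \<subseteq> closed_segment x y - {a}"
      using u a by (auto simp: closed_segment_eq_real_ivl split: if_splits)
    then show False using no_fewer_zeros[of u y] xy pos by auto
  qed
  obtain p where p: "p \<in> closed_segment x a" "p \<noteq> a" "open_segment p a \<inter> {x. g x = 0} = {}"
    using finite_avoid_segment[OF fin \<open>x \<noteq> a\<close>] .
  obtain b where b: "b \<in> closed_segment y a" "b \<noteq> a" "open_segment b a \<inter> {x. g x = 0} = {}"
    using finite_avoid_segment[OF fin \<open>y \<noteq> a\<close>] .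
  have sub: "open_segment p a \<subseteq> closed_segment x a" "open_segment b a \<subseteq> closed_segment y a"
    using p b by (auto simp: open_segment_eq_real_ivl closed_segment_eq_real_ivl split: if_splits)
  show ?thesis
  proof (rule that[of p a b])
    show "g u > 0" if "u \<in> open_segment p a" for u
      using left[of u] sub p that by force
    show "g u < 0" if "u \<in> open_segment a b" for u
      using right[of u] sub b that by (force simp: open_segment_commute)
  qed (use p b in auto)
qed

section \<open>Three tangents near an inflection point\<close>

lemma tangent_fun_eq_if_tangent_line_eq:
  "tangent_line f c = tangent_line f d \<Longrightarrow> tangent_fun f c = tangent_fun f d"
  by (auto simp: tangent_line_def fun_eq_iff set_eq_iff)

lemma tangent_fun_self: "tangent_fun f c c = f c"
  by (simp add: tangent_fun_def)

lemma illumination_index_neq_2I: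
  assumes "tangent_fun f c\<^sub>1 s = t" "tangent_fun f c\<^sub>2 s = t" "tangent_fun f c\<^sub>3 s = t"
    and "tangent_line f c\<^sub>1 \<noteq> tangent_line f c\<^sub>2" "tangent_line f c\<^sub>1 \<noteq> tangent_line f c\<^sub>3"
      "tangent_line f c\<^sub>2 \<noteq> tangent_line f c\<^sub>3"
  shows "illumination_index f (s, t) \<noteq> 2"
proof -
  let ?L = "{tangent_line f c\<^sub>1, tangent_line f c\<^sub>2, tangent_line f c\<^sub>3}"
  have "?L \<subseteq> tangents_through f (s, t)"
    using assms(1-3) by (auto simp: tangents_through_def tangent_line_def)
  moreover have "card ?L = 3"
    using assms(4-6) by simp
  ultimately have "card (tangents_through f (s, t)) \<ge> 3"
    if "finite (tangents_through f (s, t))"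
    using card_mono[OF that] by metis
  then show ?thesis
    by (auto simp: illumination_index_def numeral_eq_enat)
qed

text \<open>
  The hypotheses \<open>below\<close> and \<open>above\<close> express strict convexity and strict concavity through
  tangents. They also separate the three lines: at \<open>a\<close> the tangents from the convex side stay below
  \<open>f\<close> and the one from the concave side passes above it, and the tangent at \<open>c\<^sub>1\<close> is below \<open>f\<close> at
  the point of contact \<open>c\<^sub>2\<close>.
\<close>

lemma three_tangents_at_inflection:
  fixes f :: "real \<Rightarrow> real"
  assumes cont: "continuous_on UNIV f" "continuous_on UNIV (deriv f)"
    and "p \<noteq> a" "b \<noteq> a"
    and below: "\<And>c x. c \<in> closed_segment p a \<Longrightarrow> x \<in> closed_segment p a \<Longrightarrow> c \<noteq> x \<Longrightarrow>
      tangent_fun f c x < f x"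
    and above: "\<And>c x. c \<in> closed_segment a b \<Longrightarrow> x \<in> closed_segment a b \<Longrightarrow> c \<noteq> x \<Longrightarrow>
      f x < tangent_fun f c x"
  shows "\<exists>P. below_graph f P \<and> illumination_index f P \<noteq> 2"
proof -
  have height_cont: "continuous_on A (\<lambda>c. tangent_fun f c s)" for A s
    unfolding tangent_fun_def
    by (intro continuous_intros continuous_on_subset[OF cont(1)] continuous_on_subset[OF cont(2)])
       auto
  have IVT: "\<exists>c\<in>closed_segment u v. tangent_fun f c s = t"
    if "tangent_fun f u s \<le> t" "t \<le> tangent_fun f v s" for u v s t
  proof -
    have "connected ((\<lambda>c. tangent_fun f c s) ` closed_segment u v)"
      by (intro connected_continuous_image height_cont) auto
    then have "t \<in> (\<lambda>c. tangent_fun f c s) ` closed_segment u v"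
      by (rule connectedD_interval[OF _ _ _ that]) auto
    then show ?thesis by auto
  qed
  have "f a < tangent_fun f b a"
    using above[of b a] \<open>b \<noteq> a\<close> by auto
  moreover have "open {s. f s < tangent_fun f b s}"
    unfolding tangent_fun_def by (intro open_Collect_less continuous_intros cont)
  moreover have "a \<in> closure (open_segment p a)"
    using \<open>p \<noteq> a\<close> by (simp add: closure_open_segment)
  ultimately obtain s where s: "s \<in> open_segment p a" "f s < tangent_fun f b s"
    using open_Int_closure_eq_empty[of "{s. f s < tangent_fun f b s}" "open_segment p a"] by auto
  then have s_pa: "s \<in> closed_segment p a" "s \<noteq> p" "s \<noteq> a"
    by (auto simp: open_segment_def)
  define m where "m = max (tangent_fun f p s) (tangent_fun f a s)"
  define t where "t = (m + f s) / 2"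
  have "m < f s"
    using below[of p s] below[of a s] s_pa by (auto simp: m_def)
  then have t: "tangent_fun f p s < t" "tangent_fun f a s < t" "t < f s"
    by (auto simp: t_def m_def)
  obtain c\<^sub>1 where c1: "c\<^sub>1 \<in> closed_segment p s" "tangent_fun f c\<^sub>1 s = t"
    using IVT[of p s t s] t by (auto simp: tangent_fun_self)
  obtain c\<^sub>2 where c2: "c\<^sub>2 \<in> closed_segment a s" "tangent_fun f c\<^sub>2 s = t"
    using IVT[of a s t s] t by (auto simp: tangent_fun_self)
  obtain c\<^sub>3 where c3: "c\<^sub>3 \<in> closed_segment a b" "tangent_fun f c\<^sub>3 s = t"
    using IVT[of a s t b] t s by auto
  have "c\<^sub>1 \<noteq> s" "c\<^sub>2 \<noteq> s" "c\<^sub>2 \<noteq> a" "c\<^sub>3 \<noteq> a"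
    using c1 c2 c3 t by (auto simp: tangent_fun_self)
  then have "c\<^sub>1 \<noteq> c\<^sub>2" "c\<^sub>1 \<noteq> a" "c\<^sub>1 \<in> closed_segment p a" "c\<^sub>2 \<in> closed_segment p a"
    using c1 c2 s_pa by (auto simp: closed_segment_eq_real_ivl split: if_splits)
  then have "tangent_fun f c\<^sub>1 c\<^sub>2 < tangent_fun f c\<^sub>2 c\<^sub>2"
    "tangent_fun f c\<^sub>1 a < tangent_fun f c\<^sub>3 a" "tangent_fun f c\<^sub>2 a < tangent_fun f c\<^sub>3 a"
    using below[of c\<^sub>1 c\<^sub>2] below[of c\<^sub>1 a] below[of c\<^sub>2 a] above[of c\<^sub>3 a] c3 \<open>c\<^sub>2 \<noteq> a\<close> \<open>c\<^sub>3 \<noteq> a\<close>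
    by (auto simp: tangent_fun_self)
  then have "illumination_index f (s, t) \<noteq> 2"
    by (intro illumination_index_neq_2I[OF c1(2) c2(2) c3(2)])
       (auto dest!: tangent_fun_eq_if_tangent_line_eq)
  moreover have "below_graph f (s, t)"
    using t by (simp add: below_graph_def)
  ultimately show ?thesis by blast
qed

theorem theorem2:
  fixes f :: "real \<Rightarrow> real"
  assumes "C_k_on_reals 3 f"
    and "finite {x. (deriv ^^ 2) f x = 0}"
    and "\<exists>x. (deriv ^^ 2) f x < 0"
  shows "\<exists>P. below_graph f P \<and> illumination_index f P \<noteq> 2"
proof -
  define f'' where "f'' = (deriv ^^ 2) f"
  have diff: "(deriv ^^ j) f field_differentiable (at x)" if "j < 3" for j x
    using assms(1) that unfolding C_k_on_reals_def by blast
  have d1: "(f has_real_derivative deriv f x) (at x)" for x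
    using diff[of 0 x] by (simp add: DERIV_deriv_iff_field_differentiable)
  have d2: "(deriv f has_real_derivative f'' x) (at x)" for x
    using diff[of 1 x] by (simp add: DERIV_deriv_iff_field_differentiable f''_def eval_nat_numeral)
  have cont: "continuous_on UNIV f" "continuous_on UNIV (deriv f)" "continuous_on UNIV f''"
    using diff[of 0] diff[of 1] diff[of 2]
    by (auto simp: f''_def intro!: continuous_at_imp_continuous_on
        field_differentiable_imp_continuous_at)
  show ?thesis
  proof (cases "\<forall>x. f'' x \<le> 0")
    case True
    then have tangent_ge: "f 0 \<le> tangent_fun f c 0" for c
      unfolding tangent_fun_def using tangent_ge_if_second_deriv_nonpos[OF d1 d2] by blast
    have "tangent_fun f c 0 \<noteq> f 0 - 1" for c
      using tangent_ge[of c] by linarith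
    then have "tangents_through f (0, f 0 - 1) = {}"
      by (fastforce simp: tangents_through_def tangent_line_def)
    then have "illumination_index f (0, f 0 - 1) \<noteq> 2"
      by (simp add: illumination_index_def numeral_eq_enat)
    moreover have "below_graph f (0, f 0 - 1)"
      by (simp add: below_graph_def)
    ultimately show ?thesis by blast
  next
    case False
    then obtain x\<^sub>0 y\<^sub>0 where "f'' x\<^sub>0 > 0" "f'' y\<^sub>0 < 0"
      using assms(3) by (auto simp: f''_def not_le)
    moreover have "finite {x. f'' x = 0}"
      using assms(2) by (simp add: f''_def)
    ultimately obtain p a b where "p \<noteq> a" "b \<noteq> a"
      and pos: "\<And>u. u \<in> open_segment p a \<Longrightarrow> f'' u > 0"
      and neg: "\<And>u. u \<in> open_segment a b \<Longrightarrow> f'' u < 0"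
      using sign_change_at_zero[OF cont(3)] by metis
    have sub: "open_segment c x \<subseteq> open_segment u v"
      if "c \<in> closed_segment u v" "x \<in> closed_segment u v" for c x u v :: real
      using that
      by (auto simp: open_segment_eq_real_ivl closed_segment_eq_real_ivl split: if_splits)
    show ?thesis
    proof (rule three_tangents_at_inflection[OF cont(1,2) \<open>p \<noteq> a\<close> \<open>b \<noteq> a\<close>])
      fix c x assume "c \<in> closed_segment p a" "x \<in> closed_segment p a" "c \<noteq> x"
      then show "tangent_fun f c x < f x"
        unfolding tangent_fun_def
        using tangent_less_if_second_deriv_pos[OF d1 d2, of c x] pos sub[of c p a x] by blast
    next
      fix c x assume "c \<in> closed_segment a b" "x \<in> closed_segment a b" "c \<noteq> x"
      then show "f x < tangent_fun f c x"
        unfolding tangent_fun_def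
        using tangent_greater_if_second_deriv_neg[OF d1 d2, of c x] neg sub[of c a b x] by blast
    qed
  qed
qed

end
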